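(* Let $d \equiv 2 \pmod 4$ be a square-free positive integer such that both equations $x^2 - dy^2 = -1$ and $x^2 - dy^2 = 6$ are solvable in integers $x, y$. Let $m, k \in \mathbb{Z}$ and let $$n \in \{(4m+1) + 4k\sqrt{d},\ (4m+1) + (4k+2)\sqrt{d},\ (4m+3) + 4k\sqrt{d},\ (4m+3) + (4k+2)\sqrt{d},\ (4m+2) + (4k+2)\sqrt{d}\}.$$ Then there exist infinitely many quadruples in $\mathbb{Z}[\sqrt{d}]$ with the property $D(n)$.
   Context: For a commutative ring $\mathcal{R}$ with unity and a nonzero $n \in \mathcal{R}$, a set $\{a_1, \dots, a_m\} \subset \mathcal{R} \setminus \{0\}$ of $m$ distinct elements is called a Diophantine $m$-tuple with the property $D(n)$ (for $m=4$: a quadruple with the property $D(n)$) if $a_i a_j + n$ is a perfect square in $\mathcal{R}$ for all $1 \le i < j \le m$. *)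

theory Defs
  imports Complex_Main "HOL-Number_Theory.Cong" "HOL-Computational_Algebra.Squarefree"
begin

(* The ring R is given by its carrier, a unital subring of the ambient commutative ring;
   perfect squares are squares of elements of R, not merely of the ambient ring. *)
definition diophantine_tuple :: "nat \<Rightarrow> 'a::comm_ring_1 set \<Rightarrow> 'a \<Rightarrow> 'a set \<Rightarrow> bool" where
  "diophantine_tuple m R n A \<longleftrightarrow>
     n \<in> R - {0} \<and> A \<subseteq> R - {0} \<and> finite A \<and> card A = m \<and>
     (\<forall>a\<in>A. \<forall>b\<in>A. a \<noteq> b \<longrightarrow> (\<exists>x\<in>R. a * b + n = x\<^sup>2))"

abbreviation diophantine_quadruple :: "'a::comm_ring_1 set \<Rightarrow> 'a \<Rightarrow> 'a set \<Rightarrow> bool" where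
  "diophantine_quadruple \<equiv> diophantine_tuple 4"

(* Realised inside the reals, hence intended for d \<ge> 0. *)
definition Zsqrt :: "int \<Rightarrow> real set" where
  "Zsqrt d = {of_int a + of_int b * sqrt (of_int d) | a b. True}"

lemma ZsqrtI: "of_int a + of_int b * sqrt (of_int d) \<in> Zsqrt d"
  unfolding Zsqrt_def by blast

lemma Zsqrt_0: "0 \<in> Zsqrt d"
  using ZsqrtI[of 0 0 d] by simp

lemma Zsqrt_1: "1 \<in> Zsqrt d"
  using ZsqrtI[of 1 0 d] by simp

lemma Zsqrt_diff:
  assumes "x \<in> Zsqrt d" "y \<in> Zsqrt d"
  shows "x - y \<in> Zsqrt d"
proof -
  obtain a b a' b' where "x = of_int a + of_int b * sqrt (of_int d)"
    "y = of_int a' + of_int b' * sqrt (of_int d)"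
    using assms unfolding Zsqrt_def by blast
  then have "x - y = of_int (a - a') + of_int (b - b') * sqrt (of_int d)"
    by (simp add: algebra_simps)
  then show ?thesis by (metis ZsqrtI)
qed

lemma Zsqrt_mult:
  assumes "d \<ge> 0" "x \<in> Zsqrt d" "y \<in> Zsqrt d"
  shows "x * y \<in> Zsqrt d"
proof -
  obtain a b a' b' where "x = of_int a + of_int b * sqrt (of_int d)"
    "y = of_int a' + of_int b' * sqrt (of_int d)"
    using assms(2,3) unfolding Zsqrt_def by blast
  moreover have "sqrt (of_int d) * sqrt (of_int d) = of_int d"
    using assms(1) by simp
  ultimately have "x * y = of_int (a * a' + d * b * b') + of_int (a * b' + a' * b) * sqrt (of_int d)"
    by (simp add: algebra_simps)
  then show ?thesis by (metis ZsqrtI)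
qed

end

theory Submission
  imports Defs "HOL-Real_Asymp.Real_Asymp"
begin

text \<open>
  If \<open>3 \<nu> = \<alpha> (2 s + 1)\<close>, then \<open>\<mu>\<close>, \<open>\<mu> s\<^sup>2 + \<nu> - \<alpha>\<close>, \<open>\<mu> (s + 1)\<^sup>2 + \<nu> + \<alpha>\<close>, \<open>\<mu> (2 s + 1)\<^sup>2 + 4 \<nu>\<close>
  have the property \<open>D(\<alpha>\<^sup>2 + 2 \<mu> \<nu>)\<close>. Suppose that \<open>n = \<alpha>\<^sup>2 + 2 \<gamma>\<close> and \<open>3 \<gamma> = \<alpha> L\<close>, where the rational part
  of \<open>L\<close> is odd. A unit \<open>\<epsilon> > 1\<close> of norm \<open>-1\<close> is congruent to \<open>1 + \<surd>d\<close> modulo \<open>2\<close>, so that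
  \<open>L \<epsilon>\<^sup>-\<^sup>j\<close> is congruent to \<open>1\<close> modulo \<open>2\<close> for all \<open>j\<close> of a suitable parity; the choice \<open>\<mu> = \<epsilon>\<^sup>j\<close>,
  \<open>\<nu> = \<gamma> \<epsilon>\<^sup>-\<^sup>j\<close>, \<open>2 s + 1 = L \<epsilon>\<^sup>-\<^sup>j\<close> then gives a quadruple for all large such \<open>j\<close>.
  If the rational part of \<open>n\<close> is \<open>3\<close> or \<open>1\<close> modulo \<open>4\<close>, take \<open>\<alpha> = 1\<close> or \<open>\<alpha> = \<epsilon>\<close>, respectively.
  If \<open>n\<close> is congruent to \<open>2 + 2\<surd>d\<close> modulo \<open>4\<close>, take \<open>\<alpha>\<close> of norm \<open>6\<close> and \<open>L = \<gamma> \<alpha>' / 2\<close>, with \<open>\<alpha>'\<close> the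
  conjugate of \<open>\<alpha>\<close>.
\<close>

text \<open>Each of the six products plus \<open>n\<close> is an explicit square plus a multiple of
  \<open>3 * \<nu> - \<alpha> * (2 * s + 1)\<close>, which \<open>rel\<close> makes zero.\<close>

lemma diophantine_quadruple_family:
  fixes \<mu> s \<nu> \<alpha> n :: "'a::comm_ring_1" and R :: "'a set"
  defines "a \<equiv> \<mu>" and "b \<equiv> \<mu> * s\<^sup>2 + \<nu> - \<alpha>"
    and "c \<equiv> \<mu> * (s + 1)\<^sup>2 + \<nu> + \<alpha>" and "e \<equiv> \<mu> * (2 * s + 1)\<^sup>2 + 4 * \<nu>"
  assumes one: "1 \<in> R"
    and diff: "\<And>x y. x \<in> R \<Longrightarrow> y \<in> R \<Longrightarrow> x - y \<in> R"
    and mult: "\<And>x y. x \<in> R \<Longrightarrow> y \<in> R \<Longrightarrow> x * y \<in> R"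
    and R: "\<mu> \<in> R" "s \<in> R" "\<nu> \<in> R" "\<alpha> \<in> R"
    and rel: "3 * \<nu> = \<alpha> * (2 * s + 1)" and n: "n = \<alpha>\<^sup>2 + 2 * \<mu> * \<nu>"
    and nz: "n \<noteq> 0" "0 \<notin> {a, b, c, e}" and dist: "distinct [a, b, c, e]"
  shows "diophantine_quadruple R n {a, b, c, e}"
proof -
  have zero: "0 \<in> R" using diff[OF one one] by simp
  have add: "x + y \<in> R" if "x \<in> R" "y \<in> R" for x y
    using diff[OF that(1) diff[OF zero that(2)]] by simp
  have two: "2 \<in> R" using add[OF one one] by simp
  have four: "4 \<in> R" using add[OF two two] by simp
  note closed = add diff mult one two four R
  have mem: "n \<in> R" "a \<in> R" "b \<in> R" "c \<in> R" "e \<in> R"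
    unfolding n a_def b_def c_def e_def power2_eq_square by (intro closed)+
  \<comment> \<open>Keeping the defect \<open>E\<close> of \<open>rel\<close> as a correction term
    turns the six claims into plain polynomial identities in \<mu>, s, \<nu>, \<alpha>.\<close>
  define E where "E = 3 * \<nu> - \<alpha> * (2 * s + 1)"
  have "E = 0" by (simp add: E_def rel)
  moreover have "a * b + n = (\<mu> * s + \<alpha>)\<^sup>2 + \<mu> * E"
    "a * c + n = (\<mu> * (s + 1) + \<alpha>)\<^sup>2 + \<mu> * E"
    "a * e + n = (\<mu> * (2 * s + 1) + \<alpha>)\<^sup>2 + 2 * \<mu> * E"
    "b * c + n = (\<mu> * s * (s + 1) + \<nu>)\<^sup>2 + \<mu> * E"
    "b * e + n = (\<mu> * s * (2 * s + 1) + 2 * \<nu> - \<alpha>)\<^sup>2 + \<mu> * E"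
    "c * e + n = (\<mu> * (s + 1) * (2 * s + 1) + 2 * \<nu> + \<alpha>)\<^sup>2 + \<mu> * E"
    by (simp_all add: a_def b_def c_def e_def n E_def power2_eq_square algebra_simps)
  ultimately have "a * b + n = (\<mu> * s + \<alpha>)\<^sup>2" "a * c + n = (\<mu> * (s + 1) + \<alpha>)\<^sup>2"
    "a * e + n = (\<mu> * (2 * s + 1) + \<alpha>)\<^sup>2" "b * c + n = (\<mu> * s * (s + 1) + \<nu>)\<^sup>2"
    "b * e + n = (\<mu> * s * (2 * s + 1) + 2 * \<nu> - \<alpha>)\<^sup>2"
    "c * e + n = (\<mu> * (s + 1) * (2 * s + 1) + 2 * \<nu> + \<alpha>)\<^sup>2"
    by simp_all
  then have sq: "\<exists>x\<in>R. a * b + n = x\<^sup>2" "\<exists>x\<in>R. a * c + n = x\<^sup>2" "\<exists>x\<in>R. a * e + n = x\<^sup>2"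
    "\<exists>x\<in>R. b * c + n = x\<^sup>2" "\<exists>x\<in>R. b * e + n = x\<^sup>2" "\<exists>x\<in>R. c * e + n = x\<^sup>2"
    by (blast intro: closed)+
  then show ?thesis
    unfolding diophantine_tuple_def using mem nz dist by (auto simp: mult.commute)
qed

text \<open>If the sum vanished, squaring would give a^2 = b^2 d, odd on the left and even on the
  right.\<close>

lemma odd_plus_sqrt_nonzero:
  fixes d a b :: int
  assumes "d \<ge> 0" "even d" "odd a"
  shows "of_int a + of_int b * sqrt (of_int d) \<noteq> (0::real)"
proof
  assume "of_int a + of_int b * sqrt (of_int d) = (0::real)"
  then have "(of_int a :: real)\<^sup>2 = (of_int b * sqrt (of_int d))\<^sup>2" by algebra
  then have "(of_int (a\<^sup>2) :: real) = of_int (b\<^sup>2 * d)"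
    using assms(1) by (simp add: power_mult_distrib)
  then have "a\<^sup>2 = b\<^sup>2 * d" by (simp only: of_int_eq_iff)
  with assms show False by (metis even_mult_iff even_power)
qed

text \<open>Since d is even, \<eta>^2 = (x^2 + d y^2) + 2xy sqrt d is 1 modulo 2. So only the parity
  of the exponent matters, and \<open>t\<close> selects it.\<close>

lemma odd_times_unit_power_congruent_one:
  fixes d a b x y :: int
  assumes "d \<ge> 0" "even d" "odd a" "odd x" "odd y"
  defines "\<eta> \<equiv> (of_int x + of_int y * sqrt (of_int d) :: real)"
  obtains t where "\<And>i. \<exists>s\<in>Zsqrt d. (of_int a + of_int b * sqrt (of_int d)) * \<eta> ^ (t + 2 * i) = 2 * s + 1"
proof -
  define r :: real where "r = sqrt (of_int d)"
  define L where "L = of_int a + of_int b * r"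
  have r2: "r * r = of_int d" using assms(1) by (simp add: r_def)
  have ZI: "of_int u + of_int v * r \<in> Zsqrt d" for u v using ZsqrtI by (simp add: r_def)
  have step: "\<exists>s\<in>Zsqrt d. z * w = 2 * s + 1"
    if zw: "\<exists>s\<in>Zsqrt d. z = 2 * s + 1" "\<exists>s\<in>Zsqrt d. w = 2 * s + 1" for z w
  proof -
    obtain s s' where s: "s \<in> Zsqrt d" "s' \<in> Zsqrt d" "z = 2 * s + 1" "w = 2 * s' + 1"
      using zw by blast
    \<comment> \<open>This is 2ss' + s + s', written with differences because the closure lemmas at
      hand cover subtraction and multiplication.\<close>
    define q where "q = s * (s' - (-1)) - (0 - s') - (0 - s * s')"
    have "-1 \<in> Zsqrt d" using Zsqrt_diff[OF Zsqrt_0 Zsqrt_1] by simp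
    then have "q \<in> Zsqrt d"
      unfolding q_def by (intro Zsqrt_diff Zsqrt_mult Zsqrt_0 assms(1) s)
    moreover have "z * w = 2 * q + 1" by (simp add: s q_def algebra_simps)
    ultimately show ?thesis by blast
  qed
  have unit: "\<exists>s\<in>Zsqrt d. (of_int u + of_int v * r) * (of_int u' + of_int v' * r) = 2 * s + 1"
    if uv: "odd u" "odd u'" "even (u * v' + v * u')" for u v u' v'
  proof -
    have "odd (u * u' + d * (v * v'))" using uv assms(2) by simp
    then obtain p where p: "u * u' + d * (v * v') = 2 * p + 1" by (elim oddE)
    obtain q where q: "u * v' + v * u' = 2 * q" using uv(3) by (elim evenE)
    have "(of_int u + of_int v * r) * (of_int u' + of_int v' * r)
        = of_int (u * u' + d * (v * v')) + of_int (u * v' + v * u') * r"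
      by (simp add: r2[symmetric] algebra_simps)
    also have "\<dots> = 2 * (of_int p + of_int q * r) + 1" unfolding p q by simp
    finally show ?thesis using ZI by blast
  qed
  have \<eta>: "\<eta> = of_int x + of_int y * r" by (simp add: \<eta>_def r_def)
  have \<eta>2: "\<exists>s\<in>Zsqrt d. \<eta>\<^sup>2 = 2 * s + 1"
    unfolding \<eta> power2_eq_square by (rule unit) (use assms in auto)
  \<comment> \<open>For even b the factor is already 1 modulo 2; for odd b one factor \<eta> changes
    the coefficient of the root to ay + bx, which is even.\<close>
  define t :: nat where "t = (if even b then 0 else 1)"
  have L: "\<exists>s\<in>Zsqrt d. L * \<eta> ^ t = 2 * s + 1"
  proof (cases "even b")
    case True
    then show ?thesis using unit[where u = a and v = b and u' = 1 and v' = 0] assms by (simp add: t_def L_def)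
  next
    case False
    then show ?thesis using unit[where u = a and v = b and u' = x and v' = y] assms by (simp add: t_def L_def \<eta>)
  qed
  have "\<exists>s\<in>Zsqrt d. L * \<eta> ^ (t + 2 * i) = 2 * s + 1" for i
  proof (induction i)
    case (Suc i)
    have "L * \<eta> ^ (t + 2 * Suc i) = (L * \<eta> ^ (t + 2 * i)) * \<eta>\<^sup>2"
      by (simp add: power_add power2_eq_square)
    then show ?case using step[OF Suc \<eta>2] by (simp only:)
  qed (use L in simp)
  then show ?thesis using that[of t] by (simp add: t_def L_def r_def)
qed

text \<open>The first element of the family is a power of a unit greater than 1, hence unbounded, so
  the quadruples obtained cannot be finitely many.\<close>

lemma infinite_diophantine_quadruples:
  fixes d x y a b :: int and \<alpha> \<gamma> n :: real
  defines "L \<equiv> of_int a + of_int b * sqrt (of_int d)"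
  assumes d: "d > 0" "even d"
    and xy: "x > 0" "y > 0" "odd x" "odd y" "x\<^sup>2 - d * y\<^sup>2 = -1"
    and mem: "\<alpha> \<in> Zsqrt d" "\<gamma> \<in> Zsqrt d"
    and a: "odd a" and rel: "3 * \<gamma> = \<alpha> * L" and n: "n = \<alpha>\<^sup>2 + 2 * \<gamma>" "n \<noteq> 0"
  shows "infinite {A. diophantine_quadruple (Zsqrt d) n A}"
proof -
  define r :: real where "r = sqrt (of_int d)"
  define \<epsilon> where "\<epsilon> = of_int x + of_int y * r"
  \<comment> \<open>Minus the conjugate of \<epsilon>, which is its inverse because the norm is
    -1.\<close>
  define \<eta> where "\<eta> = of_int (- x) + of_int y * r"
  have r2: "r * r = of_int d" and r0: "r > 0" using d by (simp_all add: r_def)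
  have d0: "d \<ge> 0" using d by simp
  have ZI: "of_int u + of_int v * r \<in> Zsqrt d" for u v using ZsqrtI by (simp add: r_def)
  have "\<epsilon> * \<eta> = of_int (d * y\<^sup>2 - x\<^sup>2)"
    by (simp add: \<epsilon>_def \<eta>_def r2[symmetric] power2_eq_square algebra_simps)
  also have "d * y\<^sup>2 - x\<^sup>2 = 1" using xy by simp
  finally have inv: "\<epsilon> * \<eta> = 1" by simp
  have "of_int x \<ge> (1::real)" "of_int y * r > 0" using xy r0 by simp_all
  then have \<epsilon>1: "\<epsilon> > 1" unfolding \<epsilon>_def by linarith
  obtain t where "\<And>i. \<exists>s\<in>Zsqrt d. L * \<eta> ^ (t + 2 * i) = 2 * s + 1"
    using odd_times_unit_power_congruent_one[OF d0 d(2) a _ xy(4), of "- x" b] xy(3)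
    unfolding L_def \<eta>_def r_def even_minus by blast
  then obtain s where s: "s i \<in> Zsqrt d" "L * \<eta> ^ (t + 2 * i) = 2 * s i + 1" for i
    by metis
  define \<mu> where "\<mu> i = \<epsilon> ^ (t + 2 * i)" for i
  define \<kappa> where "\<kappa> = L\<^sup>2 + 4 * \<gamma>"
  have pow: "z ^ j \<in> Zsqrt d" if "z \<in> Zsqrt d" for z j
    by (induction j) (auto intro: Zsqrt_1 Zsqrt_mult d0 that)
  have \<mu>0: "\<mu> i > 0" for i using \<epsilon>1 by (simp add: \<mu>_def)
  have \<mu>\<eta>: "\<eta> ^ (t + 2 * i) = 1 / \<mu> i" for i
  proof -
    have "\<eta> = 1 / \<epsilon>" using inv \<epsilon>1 by (simp add: eq_divide_eq mult.commute)
    then show ?thesis by (simp only: \<mu>_def power_one_over)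
  qed
  have s_eq: "s i = (L / \<mu> i - 1) / 2" for i
    using s(2)[of i] unfolding \<mu>\<eta> by simp
  have \<mu>_lim: "filterlim \<mu> at_top sequentially"
  proof (rule filterlim_at_top_mono)
    show "filterlim (\<lambda>i. \<epsilon> ^ i) at_top sequentially"
      using \<epsilon>1 by real_asymp
    show "\<forall>\<^sub>F i in sequentially. \<epsilon> ^ i \<le> \<mu> i"
      using \<epsilon>1 by (intro always_eventually allI) (auto simp: \<mu>_def intro: power_increasing)
  qed
  obtain p q where pq: "\<alpha> = of_int p + of_int q * r" using mem(1) by (auto simp: Zsqrt_def r_def)
  obtain p' q' where pq': "\<gamma> = of_int p' + of_int q' * r" using mem(2) by (auto simp: Zsqrt_def r_def)
  have L: "L = of_int a + of_int b * r" by (simp add: L_def r_def)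
  have "L + 2 * \<alpha> = of_int (a + 2 * p) + of_int (b + 2 * q) * r"
    by (simp add: L pq algebra_simps)
  then have L\<alpha>: "L + 2 * \<alpha> \<noteq> 0"
    using odd_plus_sqrt_nonzero[of d "a + 2 * p" "b + 2 * q"] d0 d a by (simp add: r_def)
  have "\<kappa> = of_int (a\<^sup>2 + d * b\<^sup>2 + 4 * p') + of_int (2 * a * b + 4 * q') * r"
    by (simp add: \<kappa>_def L pq' r2[symmetric] power2_eq_square algebra_simps)
  moreover have "odd (a\<^sup>2 + d * b\<^sup>2 + 4 * p')" using d a by simp
  ultimately have \<kappa>: "\<kappa> \<noteq> 0"
    using odd_plus_sqrt_nonzero[OF d0 d(2), folded r_def] by metis
  \<comment> \<open>With 2s + 1 = L / \<mu>, the second and third elements grow like \<mu> / 4 and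
    differ by L + 2\<alpha>, while the fourth tends to 0 but is nonzero because \<kappa> is.\<close>
  have b_eq: "\<mu> i * (s i)\<^sup>2 + \<gamma> / \<mu> i - \<alpha> = \<mu> i / 4 - (L / 2 + \<alpha>) + \<kappa> / 4 / \<mu> i"
    and c_eq: "\<mu> i * (s i + 1)\<^sup>2 + \<gamma> / \<mu> i + \<alpha> = \<mu> i / 4 + (L / 2 + \<alpha>) + \<kappa> / 4 / \<mu> i"
    and e_eq: "\<mu> i * (2 * s i + 1)\<^sup>2 + 4 * (\<gamma> / \<mu> i) = \<kappa> / \<mu> i" for i
    using \<mu>0[of i] by (simp_all add: s_eq \<kappa>_def field_simps power2_eq_square)
  \<comment> \<open>Eventually the fourth element is below 1 and the middle two lie strictly between
    1 and \<mu>, so only the middle two could still coincide. The constant \<open>c\<close> covers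
    both signs of L/2 + \<alpha>.\<close>
  have "\<forall>\<^sub>F z in at_top. z / 4 + c + \<kappa> / 4 / z > 1 \<and> z / 4 + c + \<kappa> / 4 / z < z \<and>
      \<kappa> / z < 1 \<and> z > 1" for c :: real
    by (intro eventually_conj; real_asymp)
  from this[of "L / 2 + \<alpha>"] this[of "- (L / 2 + \<alpha>)"]
  have "\<forall>\<^sub>F z in at_top. z / 4 + (L / 2 + \<alpha>) + \<kappa> / 4 / z > 1 \<and> z / 4 + (L / 2 + \<alpha>) + \<kappa> / 4 / z < z \<and>
     z / 4 - (L / 2 + \<alpha>) + \<kappa> / 4 / z > 1 \<and> z / 4 - (L / 2 + \<alpha>) + \<kappa> / 4 / z < z \<and>
      \<kappa> / z < 1 \<and> z > 1"
    by eventually_elim simp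
  from eventually_compose_filterlim[OF this \<mu>_lim]
  have ev: "\<forall>\<^sub>F i in sequentially. \<mu> i \<in> \<Union>{A. diophantine_quadruple (Zsqrt d) n A}"
  proof eventually_elim
    case (elim i)
    let ?A = "{\<mu> i, \<mu> i * (s i)\<^sup>2 + \<gamma> / \<mu> i - \<alpha>, \<mu> i * (s i + 1)\<^sup>2 + \<gamma> / \<mu> i + \<alpha>,
      \<mu> i * (2 * s i + 1)\<^sup>2 + 4 * (\<gamma> / \<mu> i)}"
    have "diophantine_quadruple (Zsqrt d) n ?A"
    proof (rule diophantine_quadruple_family)
      show "\<mu> i \<in> Zsqrt d" unfolding \<mu>_def \<epsilon>_def by (intro pow ZI)
      show "\<gamma> / \<mu> i \<in> Zsqrt d"
        using Zsqrt_mult[OF d0 mem(2) pow[OF ZI[of "- x" y]]]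
        unfolding \<eta>_def[symmetric] \<mu>\<eta>[symmetric] by (metis \<mu>\<eta> mult.right_neutral times_divide_eq_right)
      show "3 * (\<gamma> / \<mu> i) = \<alpha> * (2 * s i + 1)"
        using rel s(2)[of i] by (simp add: \<mu>\<eta> flip: s(2))
      show "n = \<alpha>\<^sup>2 + 2 * \<mu> i * (\<gamma> / \<mu> i)" using n \<mu>0[of i] by simp
      show "0 \<notin> ?A"
        unfolding b_eq c_eq e_eq using elim \<kappa> by auto
      show "distinct [\<mu> i, \<mu> i * (s i)\<^sup>2 + \<gamma> / \<mu> i - \<alpha>, \<mu> i * (s i + 1)\<^sup>2 + \<gamma> / \<mu> i + \<alpha>,
        \<mu> i * (2 * s i + 1)\<^sup>2 + 4 * (\<gamma> / \<mu> i)]"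
        unfolding b_eq c_eq e_eq distinct.simps using elim L\<alpha> by auto
    qed (auto simp: n(2) intro: Zsqrt_1 Zsqrt_diff Zsqrt_mult d0 s(1) mem(1))
    then show ?case by blast
  qed
  show ?thesis
  proof
    assume fin: "finite {A. diophantine_quadruple (Zsqrt d) n A}"
    \<comment> \<open>Finitely many quadruples would have a finite, hence bounded, union, yet it
      contains almost all \<open>\<mu> i\<close>.\<close>
    have "finite (\<Union>{A. diophantine_quadruple (Zsqrt d) n A})"
      using fin by (rule finite_Union) (simp add: diophantine_tuple_def)
    then obtain B where B: "\<And>z. z \<in> \<Union>{A. diophantine_quadruple (Zsqrt d) n A} \<Longrightarrow> z \<le> B"
      by (meson bdd_above.E bdd_above_finite)
    have "\<forall>\<^sub>F i in sequentially. \<mu> i > B"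
      using \<mu>_lim by (simp add: filterlim_at_top_dense)
    from eventually_happens'[OF sequentially_bot eventually_conj[OF this ev]]
    obtain i where "\<mu> i > B" "\<mu> i \<in> \<Union>{A. diophantine_quadruple (Zsqrt d) n A}"
      by blast
    with B show False by fastforce
  qed
qed

theorem theorem1p1:
  fixes d m k :: int and n :: real
  assumes "d > 0" and "squarefree d" and "[d = 2] (mod 4)"
    and "\<exists>x y :: int. x\<^sup>2 - d * y\<^sup>2 = -1"
    and "\<exists>x y :: int. x\<^sup>2 - d * y\<^sup>2 = 6"
    and "n \<in> {of_int (4 * m + 1) + of_int (4 * k) * sqrt (of_int d),
              of_int (4 * m + 1) + of_int (4 * k + 2) * sqrt (of_int d),
              of_int (4 * m + 3) + of_int (4 * k) * sqrt (of_int d),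
              of_int (4 * m + 3) + of_int (4 * k + 2) * sqrt (of_int d),
              of_int (4 * m + 2) + of_int (4 * k + 2) * sqrt (of_int d)}"
  shows "infinite {A. diophantine_quadruple (Zsqrt d) n A}"
proof -
  define r :: real where "r = sqrt (of_int d)"
  have r2: "r * r = of_int d" using assms(1) by (simp add: r_def)
  have d0: "d \<ge> 0" using assms(1) by simp
  have dmod: "d mod 4 = 2" using assms(3) unfolding Cong.cong_def by simp
  define h where "h = d div 4"
  have h: "d = 4 * h + 2" using dmod unfolding h_def by presburger
  have evd: "even d" using h by simp
  obtain x0 y0 where xy0: "x0\<^sup>2 - d * y0\<^sup>2 = -1" using assms(4) by blast
  \<comment> \<open>Positive coordinates ensure that the unit exceeds 1.\<close>
  define x y where "x = \<bar>x0\<bar>" and "y = \<bar>y0\<bar>"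
  have xy: "x\<^sup>2 - d * y\<^sup>2 = -1" using xy0 by (simp add: x_def y_def)
  have "x\<^sup>2 = d * y\<^sup>2 - 1" using xy by simp
  then have "odd (x\<^sup>2)" using evd by simp
  then have oddx: "odd x" by simp
  \<comment> \<open>For even y the equation would make -1 a square modulo 4.\<close>
  have oddy: "odd y"
  proof
    assume "even y"
    then obtain v where v: "y = 2 * v" by (elim evenE)
    obtain u where u: "x = 2 * u + 1" using oddx by (elim oddE)
    have "4 * (u * u + u - d * v * v) + 2 = 0"
      using xy unfolding u v by (simp add: power2_eq_square algebra_simps)
    then show False by presburger
  qed
  have "x \<noteq> 0" "y \<noteq> 0" using oddx oddy by auto
  then have pos: "x > 0" "y > 0" by (simp_all add: x_def y_def)
  note core = infinite_diophantine_quadruples[OF assms(1) evd pos oddx oddy xy, folded r_def]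
  have ZI: "of_int u + of_int v * r \<in> Zsqrt d" for u v using ZsqrtI by (simp add: r_def)
  note nonzero = odd_plus_sqrt_nonzero[OF d0 evd, folded r_def]
  consider (three) l where "n = of_int (4 * m + 3) + of_int (2 * l) * r"
    | (one) l where "n = of_int (4 * m + 1) + of_int (2 * l) * r"
    | (two) "n = of_int (4 * m + 2) + of_int (4 * k + 2) * r"
  proof -
    have "4 * k = 2 * (2 * k)" "4 * k + 2 = 2 * (2 * k + 1)" by simp_all
    then show ?thesis using assms(6) that unfolding r_def insert_iff empty_iff by metis
  qed
  then show ?thesis
  proof cases
    \<comment> \<open>With \<alpha> = 1 one gets \<gamma> = (n - 1) / 2, whose rational part 2m + 1
      is odd, and L = 3\<gamma>.\<close>
    case three
    show ?thesis
    proof (rule core)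
      show "(1::real) \<in> Zsqrt d" by (rule Zsqrt_1)
      show "of_int (2 * m + 1) + of_int l * r \<in> Zsqrt d" by (rule ZI)
      show "odd (3 * (2 * m + 1))" by simp
      show "3 * (of_int (2 * m + 1) + of_int l * r) =
          1 * (of_int (3 * (2 * m + 1)) + of_int (3 * l) * r)"
        by (simp add: algebra_simps)
      show "n = 1\<^sup>2 + 2 * (of_int (2 * m + 1) + of_int l * r)"
        by (simp add: three algebra_simps)
      show "n \<noteq> 0" unfolding three by (rule nonzero) simp
    qed
  next
    case one
    \<comment> \<open>Here \<alpha> = 1 would give an even rational part. With \<alpha> = \<epsilon>
      = x + y r and \<epsilon>^2 = 2x^2 + 1 + 2xyr, \<gamma> = (n - \<epsilon>^2) / 2 is g + g' r
      with g odd, and L = 3\<gamma>(-x + y r).\<close>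
    define g g' where "g = 2 * m - x\<^sup>2" and "g' = l - x * y"
    have d_eq: "d * y\<^sup>2 = x\<^sup>2 + 1" using xy by simp
    have r_eq: "r * r * of_int y * of_int y = of_int x * of_int x + (1::real)"
    proof -
      have "of_int (d * y\<^sup>2) = (of_int (x\<^sup>2 + 1) :: real)" by (simp only: d_eq)
      then show ?thesis by (simp add: r2 power2_eq_square mult.assoc)
    qed
    show ?thesis
    proof (rule core)
      show "of_int x + of_int y * r \<in> Zsqrt d" by (rule ZI)
      show "of_int g + of_int g' * r \<in> Zsqrt d" by (rule ZI)
      show "odd (3 * (d * g' * y - g * x))" using oddx evd by (simp add: g_def)
      show "3 * (of_int g + of_int g' * r) = (of_int x + of_int y * r) *
          (of_int (3 * (d * g' * y - g * x)) + of_int (3 * (g * y - g' * x)) * r)"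
        using r_eq by (simp add: r2[symmetric]) algebra
      show "n = (of_int x + of_int y * r)\<^sup>2 + 2 * (of_int g + of_int g' * r)"
        unfolding one g_def g'_def using r_eq by simp algebra
      show "n \<noteq> 0" unfolding one by (rule nonzero) simp
    qed
  next
    case two
    obtain X Y where XY: "X\<^sup>2 - d * Y\<^sup>2 = 6" using assms(5) by blast
    have "X\<^sup>2 = d * Y\<^sup>2 + 6" using XY by simp
    then have "even (X\<^sup>2)" using evd by simp
    then have "even X" by simp
    then obtain p where p: "X = 2 * p" by (elim evenE)
    have eq: "d * Y\<^sup>2 = 4 * p\<^sup>2 - 6" using XY unfolding p by (simp add: power_mult_distrib)
    have oddY: "odd Y"
    proof
      assume "even Y"
      then obtain v where "Y = 2 * v" by (elim evenE)
      then have "4 * (d * v\<^sup>2) = 4 * p\<^sup>2 - 6" using eq by (simp add: power_mult_distrib)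
      then show False by presburger
    qed
    \<comment> \<open>For \<alpha> = 2p + Y r one has \<alpha>^2 = 8p^2 - 6 + 4pYr, so \<gamma> = (n
      - \<alpha>^2) / 2 is 2g + g' r.\<close>
    define g g' where "g = m + 2 - 2 * p\<^sup>2" and "g' = 2 * k + 1 - 2 * p * Y"
    have r_eq: "r * r * of_int Y * of_int Y = 4 * of_int p * of_int p - (6::real)"
    proof -
      have "of_int (d * Y\<^sup>2) = (of_int (4 * p\<^sup>2 - 6) :: real)" by (simp only: eq)
      then show ?thesis by (simp add: r2 power2_eq_square mult.assoc)
    qed
    have r2h: "r * r = 4 * of_int h + 2" using r2 h by simp
    show ?thesis
    proof (rule core)
      show "of_int (2 * p) + of_int Y * r \<in> Zsqrt d" by (rule ZI)
      show "of_int (2 * g) + of_int g' * r \<in> Zsqrt d" by (rule ZI)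
      \<comment> \<open>The rational part of L = \<gamma>(2p - Y r) / 2; it is odd because g', Y and
        d/2 = 2h + 1 are.\<close>
      show "odd (2 * g * p - g' * Y * (2 * h + 1))" using oddY by (simp add: g'_def)
      show "3 * (of_int (2 * g) + of_int g' * r) = (of_int (2 * p) + of_int Y * r) *
          (of_int (2 * g * p - g' * Y * (2 * h + 1)) + of_int (p * g' - g * Y) * r)"
        using r_eq r2h by simp algebra
      show "n = (of_int (2 * p) + of_int Y * r)\<^sup>2 + 2 * (of_int (2 * g) + of_int g' * r)"
        unfolding two g_def g'_def using r_eq by simp algebra
      \<comment> \<open>The rational part of n is even, so the parity argument is applied to n /
        2.\<close>
      have "n = 2 * (of_int (2 * m + 1) + of_int (2 * k + 1) * r)" by (simp add: two algebra_simps)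
      moreover have "of_int (2 * m + 1) + of_int (2 * k + 1) * r \<noteq> 0" by (rule nonzero) simp
      ultimately show "n \<noteq> 0" by simp
    qed
  qed
qed

end
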